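(* For any $k\in\{0,\ldots,n\}$, $$V_k=\operatorname*{ess\,inf}\,\{M_k : (M_t)_{t=k}^n\in\mathcal M_{TC,k}\},$$ where $(V_k)_{0\le k\le n}$ is the process defined by backward recursion by $V_n=-\infty$ and, for $k\in\{1,\ldots,n\}$, $$V_{k-1}=\operatorname*{ess\,inf}_{M\in\mathcal F_k}\{\mathbb E^{\mathbb Q}[M|\mathcal F_{k-1}] : M\geq V_k \text{ and } \mathbb E^{\mathbb P}[l(M-S_k)|\mathcal F_{k-1}]\leq\alpha_k\}.$$
   Context: Setting: $(\Omega,\mathcal F,\mathbb P)$ is a probability space with a discrete filtration $\mathbb F=(\mathcal F_k)_{k=0}^n$, $n\ge 1$, with $\mathcal F_0$ trivial; $\mathbb Q$ is a probability measure equivalent to $\mathbb P$; $S_0=0$ and $S_k=P_1+\dots+P_k$, where each $P_i$ is $\mathcal F_i$-measurable with $\mathbb E^{\mathbb Q}[|P_i|]<\infty$. The loss function $l:\mathbf R\to\mathbf R$ is convex, decreasing (in the weak sense) and bounded from below; $\alpha_1,\ldots,\alpha_n$ are real numbers. All supermartingales are with respect to $\mathbb F$. The notation $M\in\mathcal F_k$ means that $M$ is an $\mathcal F_k$-measurable random variable. For $k\in\{0,\ldots,n\}$, $\mathcal M_{TC,k}$ denotes the set of all $\mathbb Q$-supermartingales $(M_t)_{t=k}^n$ such that $\mathbb E^{\mathbb P}[l(M_t-S_t)|\mathcal F_{t-1}]\leq\alpha_t$ a.s. for $t=k+1,\ldots,n$. In particular $\mathcal M_{TC,n}$ is the set of all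 integrable $\mathcal F_n$-measurable random variables. *)

theory Defs
  imports "HOL-Probability.Probability"
begin

text \<open>
  The library's \<open>real_cond_exp\<close> takes a junk value wherever the conditional expectation of the
  positive or the negative part is infinite.  The extended version below is the correct value
  in \<open>[-\<infinity>, \<infinity>]\<close> wherever at most one of these two is infinite; recall that
  \<open>ennreal\<close> maps negative reals to 0 and that \<open>\<infinity> - \<infinity> = \<infinity>\<close> in \<open>ereal\<close>.
\<close>

definition ext_cond_exp :: "'a measure \<Rightarrow> 'a measure \<Rightarrow> ('a \<Rightarrow> real) \<Rightarrow> 'a \<Rightarrow> ereal" where
  "ext_cond_exp M G f = (\<lambda>\<omega>.
     enn2ereal (nn_cond_exp M G (\<lambda>x. ennreal (f x)) \<omega>)
     - enn2ereal (nn_cond_exp M G (\<lambda>x. ennreal (- f x)) \<omega>))"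

definition cond_exp_exists :: "'a measure \<Rightarrow> 'a measure \<Rightarrow> ('a \<Rightarrow> real) \<Rightarrow> bool" where
  "cond_exp_exists M G f \<longleftrightarrow>
     (AE \<omega> in M. nn_cond_exp M G (\<lambda>x. ennreal (f x)) \<omega> < \<infinity>
               \<or> nn_cond_exp M G (\<lambda>x. ennreal (- f x)) \<omega> < \<infinity>)"

text \<open>
  The essential infimum of a family of random variables is its greatest almost sure
  lower bound; it is unique only up to null sets, so \<open>ess_inf\<close> picks a version.
\<close>

definition is_ess_inf :: "'a measure \<Rightarrow> ('a \<Rightarrow> ereal) set \<Rightarrow> ('a \<Rightarrow> ereal) \<Rightarrow> bool" where
  "is_ess_inf M \<Phi> Y \<longleftrightarrow>
     Y \<in> borel_measurable M \<and>
     (\<forall>X\<in>\<Phi>. AE \<omega> in M. Y \<omega> \<le> X \<omega>) \<and>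
     (\<forall>Z\<in>borel_measurable M. (\<forall>X\<in>\<Phi>. AE \<omega> in M. Z \<omega> \<le> X \<omega>) \<longrightarrow> (AE \<omega> in M. Z \<omega> \<le> Y \<omega>))"

definition ess_inf :: "'a measure \<Rightarrow> ('a \<Rightarrow> ereal) set \<Rightarrow> 'a \<Rightarrow> ereal" where
  "ess_inf M \<Phi> = (SOME Y. is_ess_inf M \<Phi> Y)"

lemma is_ess_inf_unique:
  assumes "is_ess_inf M \<Phi> Y" and "is_ess_inf M \<Phi> Y'"
  shows "AE \<omega> in M. Y \<omega> = Y' \<omega>"
proof -
  have "AE \<omega> in M. Y \<omega> \<le> Y' \<omega>" "AE \<omega> in M. Y' \<omega> \<le> Y \<omega>"
    using assms unfolding is_ess_inf_def by blast+
  then show ?thesis by eventually_elim auto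
qed

lemma (in finite_measure) countable_Union_essentially_maximal:
  assumes "\<A> \<subseteq> sets M"
  shows "\<exists>\<C>. countable \<C> \<and> \<C> \<subseteq> \<A> \<and> (\<forall>B\<in>\<A>. B - \<Union>\<C> \<in> null_sets M)"
proof -
  define D where "D = {\<C>. countable \<C> \<and> \<C> \<subseteq> \<A>}"
  define s where "s = (SUP \<C>\<in>D. emeasure M (\<Union>\<C>))"
  have D: "\<Union>\<C> \<in> sets M" if "\<C> \<in> D" for \<C>
    using that assms unfolding D_def by (auto intro!: sets.countable_Union)
  have "D \<noteq> {}" unfolding D_def by auto
  then obtain f where f: "range f \<subseteq> (\<lambda>\<C>. emeasure M (\<Union>\<C>)) ` D" "s = (SUP i::nat. f i)"
    using ennreal_Sup_countable_SUP[of "(\<lambda>\<C>. emeasure M (\<Union>\<C>)) ` D"]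
    unfolding s_def by auto
  then have "\<forall>i. \<exists>\<C>\<in>D. f i = emeasure M (\<Union>\<C>)" by blast
  then have "\<exists>c. \<forall>i. c i \<in> D \<and> f i = emeasure M (\<Union>(c i))" by (intro choice) blast
  then obtain c where c: "\<And>i. c i \<in> D" "\<And>i. f i = emeasure M (\<Union>(c i))" by blast
  define \<C> where "\<C> = (\<Union>i. c i)"
  have C: "\<C> \<in> D" using c(1) unfolding \<C>_def D_def by auto
  have "s \<le> emeasure M (\<Union>\<C>)"
    unfolding f(2) c(2) using D[OF C]
    by (intro SUP_least emeasure_mono) (auto simp: \<C>_def)
  moreover have "B - \<Union>\<C> \<in> null_sets M" if "B \<in> \<A>" "s \<le> emeasure M (\<Union>\<C>)" for B
  proof -
    have B: "B \<in> sets M" using that assms by auto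
    have ins: "insert B \<C> \<in> D" using C that(1) unfolding D_def by auto
    have "emeasure M (\<Union>\<C>) + emeasure M (B - \<Union>\<C>) = emeasure M (\<Union>\<C> \<union> (B - \<Union>\<C>))"
      using B D[OF C] by (intro plus_emeasure) auto
    also have "\<Union>\<C> \<union> (B - \<Union>\<C>) = \<Union>(insert B \<C>)" by auto
    also have "emeasure M \<dots> \<le> s" unfolding s_def using ins by (rule SUP_upper)
    also note that(2)
    finally have "emeasure M (\<Union>\<C>) + emeasure M (B - \<Union>\<C>) \<le> emeasure M (\<Union>\<C>) + 0"
      by simp
    then have "emeasure M (B - \<Union>\<C>) = 0"
      unfolding ennreal_add_left_cancel_le by simp
    then show ?thesis using B D[OF C] by auto
  qed
  ultimately show ?thesis using C unfolding D_def by blast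
qed

lemma (in finite_measure) is_ess_inf_exists:
  assumes \<Phi>: "\<Phi> \<subseteq> borel_measurable M"
  shows "\<exists>Y. is_ess_inf M \<Phi> Y"
proof -
  define L where "L q X = {\<omega> \<in> space M. X \<omega> < ereal (real_of_rat q)}" for q and X :: "'a \<Rightarrow> ereal"
  have L: "L q X \<in> sets M" if "X \<in> \<Phi>" for q X
    using that \<Phi> unfolding L_def by (auto intro!: borel_measurable_less)
  have "\<exists>C. countable C \<and> C \<subseteq> \<Phi> \<and> (\<forall>X\<in>\<Phi>. L q X - (\<Union>X'\<in>C. L q X') \<in> null_sets M)" for q
  proof -
    have "L q ` \<Phi> \<subseteq> sets M" using L by auto
    from countable_Union_essentially_maximal[OF this] obtain \<C>
      where \<C>: "countable \<C>" "\<C> \<subseteq> L q ` \<Phi>" "\<forall>B\<in>L q ` \<Phi>. B - \<Union>\<C> \<in> null_sets M" by blast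
    from countable_subset_image[of \<C> "L q" \<Phi>] \<C>(1,2) obtain C
      where "countable C" "C \<subseteq> \<Phi>" "\<C> = L q ` C" by blast
    then show ?thesis using \<C>(3) by (intro exI[of _ C]) auto
  qed
  then obtain C where C: "\<And>q. countable (C q)" "\<And>q. C q \<subseteq> \<Phi>"
    "\<And>q X. X \<in> \<Phi> \<Longrightarrow> L q X - (\<Union>X'\<in>C q. L q X') \<in> null_sets M" by metis
  define A where "A = (\<Union>q. C q)"
  have A: "countable A" "A \<subseteq> \<Phi>" using C(1,2) unfolding A_def by auto
  define Y where "Y = (\<lambda>\<omega>. INF X\<in>A. X \<omega>)"
  have "Y \<in> borel_measurable M"
    unfolding Y_def using A \<Phi> by (intro borel_measurable_INF) auto
  moreover have "AE \<omega> in M. Y \<omega> \<le> X \<omega>" if X: "X \<in> \<Phi>" for X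
  proof -
    have "AE \<omega> in M. \<forall>q. \<omega> \<notin> L q X - (\<Union>X'\<in>C q. L q X')"
      unfolding AE_all_countable using AE_not_in[OF C(3)[OF X]] by blast
    then show ?thesis
    proof (rule AE_mp, intro AE_I2 impI)
      fix \<omega> assume \<omega>: "\<omega> \<in> space M" and *: "\<forall>q. \<omega> \<notin> L q X - (\<Union>X'\<in>C q. L q X')"
      show "Y \<omega> \<le> X \<omega>"
      proof (rule ccontr)
        assume "\<not> Y \<omega> \<le> X \<omega>"
        then obtain r s where rs: "X \<omega> < ereal r" "ereal r < ereal s" "ereal s < Y \<omega>"
          by (metis ereal_dense2 linorder_not_le)
        then obtain q where q: "r < real_of_rat q" "real_of_rat q < s"
          using of_rat_dense by auto
        have "X \<omega> < ereal (real_of_rat q)" using rs(1) q(1) by (meson ereal_less_eq(3) less_imp_le order_less_le_trans)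
        then obtain X' where X': "X' \<in> C q" "X' \<omega> < ereal (real_of_rat q)"
          using * \<omega> unfolding L_def by auto
        have "Y \<omega> \<le> X' \<omega>" unfolding Y_def using X'(1) by (intro INF_lower) (auto simp: A_def)
        also note X'(2)
        also have "ereal (real_of_rat q) < ereal s" using q by simp
        finally show False using rs by simp
      qed
    qed
  qed
  moreover have "AE \<omega> in M. Z \<omega> \<le> Y \<omega>" if "\<forall>X\<in>\<Phi>. AE \<omega> in M. Z \<omega> \<le> X \<omega>" for Z
  proof -
    have "AE \<omega> in M. \<forall>X\<in>A. Z \<omega> \<le> X \<omega>"
      using that A by (subst AE_ball_countable) auto
    then show ?thesis by eventually_elim (auto simp: Y_def intro: INF_greatest)
  qed
  ultimately show ?thesis unfolding is_ess_inf_def by blast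
qed

lemma (in finite_measure) is_ess_inf_ess_inf:
  assumes "\<Phi> \<subseteq> borel_measurable M"
  shows "is_ess_inf M \<Phi> (ess_inf M \<Phi>)"
  unfolding ess_inf_def using is_ess_inf_exists[OF assms] by (rule someI_ex)

definition supermartingale ::
    "'a measure \<Rightarrow> (nat \<Rightarrow> 'a measure) \<Rightarrow> nat set \<Rightarrow> (nat \<Rightarrow> 'a \<Rightarrow> real) \<Rightarrow> bool" where
  "supermartingale Q F I M \<longleftrightarrow>
     (\<forall>t\<in>I. M t \<in> borel_measurable (F t) \<and> integrable Q (M t)) \<and>
     (\<forall>s\<in>I. \<forall>t\<in>I. s \<le> t \<longrightarrow> (AE \<omega> in Q. real_cond_exp Q (F s) (M t) \<omega> \<le> M s \<omega>))"

definition loss_constraint ::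
    "'a measure \<Rightarrow> (nat \<Rightarrow> 'a measure) \<Rightarrow> (nat \<Rightarrow> 'a \<Rightarrow> real) \<Rightarrow> (real \<Rightarrow> real) \<Rightarrow> (nat \<Rightarrow> real)
      \<Rightarrow> nat \<Rightarrow> ('a \<Rightarrow> real) \<Rightarrow> bool" where
  "loss_constraint P F S l \<alpha> t X \<longleftrightarrow>
     (AE \<omega> in P. ext_cond_exp P (F (t - 1)) (\<lambda>x. l (X x - S t x)) \<omega> \<le> ereal (\<alpha> t))"

text \<open>
  Processes are indexed by all of \<open>nat\<close>; the values outside \<open>{k..n}\<close> are irrelevant here.
\<close>

definition M_TC ::
    "'a measure \<Rightarrow> 'a measure \<Rightarrow> (nat \<Rightarrow> 'a measure) \<Rightarrow> (nat \<Rightarrow> 'a \<Rightarrow> real) \<Rightarrow> (real \<Rightarrow> real)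
      \<Rightarrow> (nat \<Rightarrow> real) \<Rightarrow> nat \<Rightarrow> nat \<Rightarrow> (nat \<Rightarrow> 'a \<Rightarrow> real) set" where
  "M_TC P Q F S l \<alpha> n k =
     {M. supermartingale Q F {k..n} M \<and> (\<forall>t\<in>{k+1..n}. loss_constraint P F S l \<alpha> t (M t))}"

end

theory Submission
  imports Defs
begin

text \<open>
  One inequality is direct: a process started at time \<open>k - 1\<close> is also one started at time \<open>k\<close>,
  so by backward induction its value at \<open>k\<close> competes in the definition of \<open>V (k - 1)\<close>.
  Conversely, let \<open>M\<close> be a competitor.  The family of the values at time \<open>k\<close> is closed under
  minima (paste two processes along an \<open>F k\<close>-measurable set), so a decreasing sequence \<open>N j\<close> of
  processes has \<open>N j k\<close> tending to \<open>V k\<close>, and hence \<open>max M (max (N j k) (- j))\<close> decreases to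
  \<open>M\<close>.  Each of these variables dominates \<open>N j k\<close> and satisfies the loss constraint because \<open>M\<close>
  does, so it can replace the initial value of \<open>N j\<close>, and the process extends to time \<open>k - 1\<close> by its
  conditional expectation; conditional monotone convergence concludes.  Truncating at \<open>- j\<close>
  handles a non-integrable negative part of \<open>M\<close>, and a non-integrable positive part is handled by
  localisation on an \<open>F (k - 1)\<close>-measurable set.
\<close>

section \<open>Extended conditional expectations\<close>

context sigma_finite_subalgebra
begin

text \<open>The indicator of \<open>A\<close> is \<open>F\<close>-measurable, so it can be pulled
  out of both conditional expectations, and the two products under them coincide. All later pasting
  along sets of the conditioning sigma-algebra rests on this.\<close>

lemma nn_cond_exp_local:
  assumes A: "A \<in> sets F" and [measurable]: "f \<in> borel_measurable M" "g \<in> borel_measurable M"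
    and eq: "\<And>x. x \<in> A \<Longrightarrow> f x = g x"
  shows "AE x in M. x \<in> A \<longrightarrow> nn_cond_exp M F f x = nn_cond_exp M F g x"
proof -
  have ind: "(indicator A :: 'a \<Rightarrow> ennreal) \<in> borel_measurable F" using A by simp
  have "(\<lambda>x. indicator A x * f x) = (\<lambda>x. indicator A x * g x)"
    using eq by (auto simp: indicator_def)
  with nn_cond_exp_prod[OF ind assms(2)] nn_cond_exp_prod[OF ind assms(3)]
  show ?thesis by (auto simp: indicator_def elim!: eventually_elim2)
qed

lemma ext_cond_exp_local:
  assumes "A \<in> sets F" and [measurable]: "f \<in> borel_measurable M" "g \<in> borel_measurable M"
    and eq: "\<And>x. x \<in> A \<Longrightarrow> f x = g x"
  shows "AE x in M. x \<in> A \<longrightarrow> ext_cond_exp M F f x = ext_cond_exp M F g x"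
proof -
  have "AE x in M. x \<in> A \<longrightarrow> nn_cond_exp M F (\<lambda>x. ennreal (f x)) x = nn_cond_exp M F (\<lambda>x. ennreal (g x)) x"
    "AE x in M. x \<in> A \<longrightarrow> nn_cond_exp M F (\<lambda>x. ennreal (- f x)) x = nn_cond_exp M F (\<lambda>x. ennreal (- g x)) x"
    by (intro nn_cond_exp_local assms(1); simp add: eq)+
  then show ?thesis by eventually_elim (auto simp: ext_cond_exp_def)
qed

text \<open>With \<open>\<infinity> - \<infinity> = \<infinity>\<close>, subtraction on
  \<open>ereal\<close> is isotone in its first and antitone in its second argument, so it suffices
  to compare the conditional expectations of the positive and of the negative parts.\<close>

lemma ext_cond_exp_mono:
  assumes le: "AE x in M. f x \<le> g x" and [measurable]: "f \<in> borel_measurable M" "g \<in> borel_measurable M"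
  shows "AE x in M. ext_cond_exp M F f x \<le> ext_cond_exp M F g x"
proof -
  have "AE x in M. nn_cond_exp M F (\<lambda>x. ennreal (f x)) x \<le> nn_cond_exp M F (\<lambda>x. ennreal (g x)) x"
    using le by (intro nn_cond_exp_mono) (auto simp: ennreal_leI)
  moreover have "AE x in M. nn_cond_exp M F (\<lambda>x. ennreal (- g x)) x \<le> nn_cond_exp M F (\<lambda>x. ennreal (- f x)) x"
    using le by (intro nn_cond_exp_mono) (auto simp: ennreal_leI)
  ultimately show ?thesis
    by eventually_elim (auto simp: ext_cond_exp_def less_eq_ennreal.rep_eq intro!: ereal_minus_mono)
qed

lemma nn_cond_exp_finite:
  assumes [measurable]: "f \<in> borel_measurable M" and fin: "(\<integral>\<^sup>+x. f x \<partial>M) < \<infinity>"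
  shows "AE x in M. nn_cond_exp M F f x < \<infinity>"
proof -
  have "(\<integral>\<^sup>+x. nn_cond_exp M F f x \<partial>M) < \<infinity>"
    using nn_cond_exp_intg[of "\<lambda>_. 1" f] fin by simp
  then have "AE x in M. nn_cond_exp M F f x \<noteq> \<infinity>" by (intro nn_integral_PInf_AE) auto
  then show ?thesis by (auto simp: less_top)
qed

lemma nn_cond_exp_integrable_finite:
  fixes f :: "'a \<Rightarrow> real"
  assumes "integrable M f"
  shows "AE x in M. nn_cond_exp M F (\<lambda>x. ennreal (f x)) x < \<infinity>"
    and "AE x in M. nn_cond_exp M F (\<lambda>x. ennreal (- f x)) x < \<infinity>"
proof -
  note [measurable] = borel_measurable_integrable[OF assms]
  have "(\<integral>\<^sup>+x. ennreal (f x) \<partial>M) \<le> (\<integral>\<^sup>+x. ennreal (norm (f x)) \<partial>M)"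
    "(\<integral>\<^sup>+x. ennreal (- f x) \<partial>M) \<le> (\<integral>\<^sup>+x. ennreal (norm (f x)) \<partial>M)"
    by (auto intro!: nn_integral_mono ennreal_leI)
  moreover have "(\<integral>\<^sup>+x. ennreal (norm (f x)) \<partial>M) < \<infinity>"
    using assms by (simp add: integrable_iff_bounded)
  ultimately show "AE x in M. nn_cond_exp M F (\<lambda>x. ennreal (f x)) x < \<infinity>"
    "AE x in M. nn_cond_exp M F (\<lambda>x. ennreal (- f x)) x < \<infinity>"
    by (auto intro!: nn_cond_exp_finite[simplified] simp: order_le_less_trans)
qed

lemma integrable_cond_exp_exists:
  assumes "integrable M f"
  shows "cond_exp_exists M F f"
  using nn_cond_exp_integrable_finite(1)[OF assms] unfolding cond_exp_exists_def
  by eventually_elim auto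

lemma ext_cond_exp_integrable:
  assumes "integrable M f"
  shows "AE x in M. ext_cond_exp M F f x = ereal (real_cond_exp M F f x)"
  using nn_cond_exp_integrable_finite[OF assms]
proof eventually_elim
  case (elim x)
  then show ?case unfolding ext_cond_exp_def real_cond_exp_def
    by (cases "nn_cond_exp M F (\<lambda>x. ennreal (f x)) x"; cases "nn_cond_exp M F (\<lambda>x. ennreal (- f x)) x")
      (auto simp: enn2ereal_ennreal)
qed

text \<open>The supremum is tested against sets \<open>A\<close> of the sub-sigma-algebra: monotone
  convergence takes it out of the integral, each \<open>nn_cond_exp M F (f i)\<close> is traded for
  \<open>f i\<close>, and monotone convergence puts it back.\<close>

lemma nn_cond_exp_monotone_convergence:
  assumes [measurable]: "\<And>i. f i \<in> borel_measurable M" "g \<in> borel_measurable M"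
    and inc: "incseq f" and sup: "AE x in M. (SUP i. f i x) = g x"
  shows "AE x in M. (SUP i. nn_cond_exp M F (f i) x) = nn_cond_exp M F g x"
proof (rule nn_cond_exp_charact)
  fix A assume A[measurable]: "A \<in> sets F"
  have AM: "A \<in> sets M" using A subalg by (auto simp: subalgebra_def)
  have mono: "AE x in M. nn_cond_exp M F (f i) x \<le> nn_cond_exp M F (f (Suc i)) x" for i
    using inc by (intro nn_cond_exp_mono) (auto simp: incseq_Suc_iff le_fun_def)
  have "(\<integral>\<^sup>+x\<in>A. (SUP i. nn_cond_exp M F (f i) x) \<partial>M) = (\<integral>\<^sup>+x. (SUP i. indicator A x * nn_cond_exp M F (f i) x) \<partial>M)"
    by (simp add: SUP_mult_left_ennreal mult.commute)
  \<comment> \<open>The conditional expectations increase in \<open>i\<close> only almost surely,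
    hence the AE form of monotone convergence here; the \<open>f i\<close> themselves increase
    pointwise.\<close>
  also have "\<dots> = (SUP i. \<integral>\<^sup>+x. indicator A x * nn_cond_exp M F (f i) x \<partial>M)"
  proof (intro nn_integral_monotone_convergence_SUP_AE)
    show "AE x in M. indicator A x * nn_cond_exp M F (f i) x \<le> indicator A x * nn_cond_exp M F (f (Suc i)) x" for i
      using mono[of i] by eventually_elim (rule mult_left_mono, simp_all)
  qed (use AM in auto)
  also have "\<dots> = (SUP i. \<integral>\<^sup>+x. indicator A x * f i x \<partial>M)"
    by (simp add: nn_cond_exp_intg)
  also have "\<dots> = (\<integral>\<^sup>+x. (SUP i. indicator A x * f i x) \<partial>M)"
    using AM inc by (intro nn_integral_monotone_convergence_SUP[symmetric])
      (auto simp: incseq_def le_fun_def intro!: mult_left_mono)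
  also have "\<dots> = (\<integral>\<^sup>+x\<in>A. g x \<partial>M)"
    using sup by (intro nn_integral_cong_AE) (auto simp: SUP_mult_left_ennreal[symmetric] mult.commute)
  finally show "(\<integral>\<^sup>+x\<in>A. g x \<partial>M) = (\<integral>\<^sup>+x\<in>A. (SUP i. nn_cond_exp M F (f i) x) \<partial>M)" by simp
qed auto

text \<open>Conditional monotone convergence from above, for a limit \<open>f\<close> whose negative
  part may fail to be integrable. The increasing version is applied to the nonnegative differences
  \<open>X 0 - X j\<close>, and the bound is carried over to \<open>f\<close> by arithmetic at each
  point.\<close>

lemma le_ext_cond_exp_decseq:
  fixes X :: "nat \<Rightarrow> 'a \<Rightarrow> real"
  assumes int: "\<And>j. integrable M (X j)" and [measurable]: "f \<in> borel_measurable M"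
    and dec: "decseq X" and lim: "AE x in M. (\<lambda>j. X j x) \<longlonglongrightarrow> f x"
    and Z: "\<And>j. AE x in M. Z x \<le> ereal (real_cond_exp M F (X j) x)"
  shows "AE x in M. Z x \<le> ext_cond_exp M F f x"
proof -
  note [measurable] = borel_measurable_integrable[OF int]
  let ?E = "\<lambda>h. nn_cond_exp M F (\<lambda>x. ennreal (h x))"
  have anti: "X j x \<le> X i x" if "i \<le> j" for i j x
    using decseqD[OF dec that] by (auto simp: le_fun_def)
  then have le: "X j x \<le> X 0 x" for j x by simp
  have fle: "AE x in M. f x \<le> X 0 x"
    using lim by eventually_elim (rule LIMSEQ_le_const2, auto intro: le)
  have inc: "incseq (\<lambda>j x. ennreal (X 0 x - X j x))"
    using anti by (auto simp: incseq_def le_fun_def intro!: ennreal_leI)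
  have "AE x in M. (SUP j. ?E (\<lambda>x. X 0 x - X j x) x) = ?E (\<lambda>x. X 0 x - f x) x"
  proof (rule nn_cond_exp_monotone_convergence[OF _ _ inc])
    show "AE x in M. (SUP i. ennreal (X 0 x - X i x)) = ennreal (X 0 x - f x)"
      using lim
    proof eventually_elim
      case (elim x)
      have "(\<lambda>j. ennreal (X 0 x - X j x)) \<longlonglongrightarrow> ennreal (X 0 x - f x)"
        by (intro tendsto_ennrealI tendsto_intros elim)
      moreover have "(\<lambda>j. ennreal (X 0 x - X j x)) \<longlonglongrightarrow> (SUP i. ennreal (X 0 x - X i x))"
        using inc by (intro LIMSEQ_SUP) (auto simp: incseq_def le_fun_def)
      ultimately show ?case using LIMSEQ_unique by blast
    qed
  qed auto
  \<comment> \<open>This is \<open>X 0 - f = X 0 - f\<close> with every negative part moved to the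
    other side: only sums of nonnegative terms occur, so it survives infinite values. It relies on
    \<open>f \<le> X 0\<close> almost everywhere and on \<open>ennreal\<close> cutting reals off at
    0.\<close>
  moreover have "AE x in M. ?E (\<lambda>x. X 0 x - f x) x + ?E f x + ?E (\<lambda>x. - X 0 x) x
      = ?E (X 0) x + ?E (\<lambda>x. - f x) x"
  proof -
    have "AE x in M. ennreal (X 0 x - f x) + ennreal (f x) + ennreal (- X 0 x) = ennreal (X 0 x) + ennreal (- f x)"
      using fle
    proof eventually_elim
      case (elim x)
      have "ennreal a = ennreal (max a 0)" for a by (simp add: ennreal_neg max_def)
      moreover have "max (X 0 x - f x) 0 + max (f x) 0 + max (- X 0 x) 0 = max (X 0 x) 0 + max (- f x) 0"
        using elim by (auto simp: max_def)
      ultimately show ?case by (metis ennreal_plus add_nonneg_nonneg max.cobounded2)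
    qed
    then have "AE x in M. nn_cond_exp M F (\<lambda>x. ennreal (X 0 x - f x) + ennreal (f x) + ennreal (- X 0 x)) x
      = nn_cond_exp M F (\<lambda>x. ennreal (X 0 x) + ennreal (- f x)) x"
      by (intro nn_cond_exp_cong) auto
    moreover have "AE x in M. nn_cond_exp M F (\<lambda>x. ennreal (X 0 x - f x) + ennreal (f x)) x + ?E (\<lambda>x. - X 0 x) x =
        nn_cond_exp M F (\<lambda>x. (ennreal (X 0 x - f x) + ennreal (f x)) + ennreal (- X 0 x)) x"
      "AE x in M. ?E (\<lambda>x. X 0 x - f x) x + ?E f x = nn_cond_exp M F (\<lambda>x. ennreal (X 0 x - f x) + ennreal (f x)) x"
      "AE x in M. ?E (X 0) x + ?E (\<lambda>x. - f x) x = nn_cond_exp M F (\<lambda>x. ennreal (X 0 x) + ennreal (- f x)) x"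
      by (intro nn_cond_exp_sum; measurable)+
    ultimately show ?thesis by eventually_elim simp
  qed
  moreover have "AE x in M. ?E f x \<le> ?E (X 0) x"
    using fle by (intro nn_cond_exp_mono) (auto intro: ennreal_leI)
  moreover note nn_cond_exp_integrable_finite[OF int, of 0]
  moreover have "AE x in M. \<forall>j. Z x \<le> ereal (real_cond_exp M F (X j) x)
      \<and> real_cond_exp M F (\<lambda>x. X 0 x - X j x) x = real_cond_exp M F (X 0) x - real_cond_exp M F (X j) x
      \<and> ?E (\<lambda>x. X 0 x - X j x) x < \<infinity>
      \<and> real_cond_exp M F (\<lambda>x. X 0 x - X j x) x = enn2real (?E (\<lambda>x. X 0 x - X j x) x)"
  proof (unfold AE_all_countable, intro allI)
    fix j
    have "(\<lambda>x. ennreal (- (X 0 x - X j x))) = (\<lambda>x. 0)" using le[of j] by (auto simp: ennreal_neg)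
    moreover have "AE x in M. 0 = nn_cond_exp M F (\<lambda>x. 0) x" by (intro nn_cond_exp_F_meas) simp
    ultimately have "AE x in M. real_cond_exp M F (\<lambda>x. X 0 x - X j x) x = enn2real (?E (\<lambda>x. X 0 x - X j x) x)"
      unfolding real_cond_exp_def by auto
    moreover have "AE x in M. ?E (\<lambda>x. X 0 x - X j x) x < \<infinity>"
      by (intro nn_cond_exp_integrable_finite Bochner_Integration.integrable_diff int)
    ultimately show "AE x in M. Z x \<le> ereal (real_cond_exp M F (X j) x)
      \<and> real_cond_exp M F (\<lambda>x. X 0 x - X j x) x = real_cond_exp M F (X 0) x - real_cond_exp M F (X j) x
      \<and> ?E (\<lambda>x. X 0 x - X j x) x < \<infinity>
      \<and> real_cond_exp M F (\<lambda>x. X 0 x - X j x) x = enn2real (?E (\<lambda>x. X 0 x - X j x) x)"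
      using Z[of j] real_cond_exp_diff[OF int int, of 0 j] by eventually_elim blast
  qed
  ultimately show ?thesis
  proof eventually_elim
    case (elim x)
    let ?r = "real_cond_exp M F (X 0) x" and ?d = "?E (\<lambda>x. X 0 x - f x) x"
    have r: "?r = enn2real (?E (X 0) x) - enn2real (?E (\<lambda>x. - X 0 x) x)"
      by (simp add: real_cond_exp_def)
    show ?case
    proof (cases "Z x")
      case (real z)
      \<comment> \<open>Since \<open>z\<close> is below the conditional expectation of
        \<open>X j\<close>, that of \<open>X 0 - X j\<close> is at most \<open>?r - z\<close>. This
        bound passes to the supremum \<open>?d\<close>; hence \<open>?d\<close> is finite, and the
        additive identity above gives \<open>z\<close> as a lower bound for
        \<open>f\<close>.\<close>
      have "?E (\<lambda>x. X 0 x - X j x) x \<le> ennreal (?r - z)" for j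
      proof -
        have "z \<le> ?r - enn2real (?E (\<lambda>x. X 0 x - X j x) x)"
          using elim(6)[rule_format, of j] real by auto
        then have "ennreal (enn2real (?E (\<lambda>x. X 0 x - X j x) x)) \<le> ennreal (?r - z)" by (intro ennreal_leI) simp
        then show ?thesis using elim(6)[rule_format, of j] by simp
      qed
      then have d: "?d \<le> ennreal (?r - z)" unfolding elim(1)[symmetric] by (rule SUP_least)
      have "z \<le> ?r" using elim(6)[rule_format, of 0] real by auto
      with d elim(2-5) r real show ?thesis
        unfolding ext_cond_exp_def
        by (cases ?d; cases "?E f x"; cases "?E (X 0) x"; cases "?E (\<lambda>x. - X 0 x) x"; cases "?E (\<lambda>x. - f x) x")
          (auto simp: enn2ereal_ennreal ennreal_plus[symmetric] top_unique simp del: ennreal_plus)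
    next
      case PInf
      then show ?thesis using elim(6)[rule_format, of 0] by simp
    qed simp
  qed
qed

end

section \<open>Essential infima\<close>

text \<open>For each rational \<open>q\<close>, countably many members have sublevel sets that cover
  every other sublevel set at \<open>q\<close> up to a null set. The union of these families over
  \<open>q\<close> has an infimum almost surely below each member, hence equal to \<open>Y\<close>.
  Countability is what later allows a sequence to be built.\<close>

lemma (in finite_measure) is_ess_inf_countable:
  assumes \<Phi>: "\<Phi> \<subseteq> borel_measurable M" and Y: "is_ess_inf M \<Phi> Y"
  obtains C where "countable C" "C \<subseteq> \<Phi>" "AE \<omega> in M. (INF X\<in>C. X \<omega>) = Y \<omega>"
proof -
  define L where "L q X = {\<omega> \<in> space M. X \<omega> < ereal (real_of_rat q)}" for q and X :: "'a \<Rightarrow> ereal"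
  have "\<exists>C. countable C \<and> C \<subseteq> \<Phi> \<and> (\<forall>X\<in>\<Phi>. L q X - (\<Union>X'\<in>C. L q X') \<in> null_sets M)" for q
  proof -
    have "L q ` \<Phi> \<subseteq> sets M" using \<Phi> unfolding L_def by (auto intro!: borel_measurable_less)
    from countable_Union_essentially_maximal[OF this] obtain \<C>
      where \<C>: "countable \<C>" "\<C> \<subseteq> L q ` \<Phi>" "\<forall>B\<in>L q ` \<Phi>. B - \<Union>\<C> \<in> null_sets M" by blast
    from countable_subset_image[of \<C> "L q" \<Phi>] \<C>(1,2) obtain C
      where "countable C" "C \<subseteq> \<Phi>" "\<C> = L q ` C" by blast
    then show ?thesis using \<C>(3) by (intro exI[of _ C]) auto
  qed
  then obtain C where C: "\<And>q. countable (C q)" "\<And>q. C q \<subseteq> \<Phi>"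
    "\<And>q X. X \<in> \<Phi> \<Longrightarrow> L q X - (\<Union>X'\<in>C q. L q X') \<in> null_sets M" by metis
  define A where "A = (\<Union>q. C q)"
  have A: "countable A" "A \<subseteq> \<Phi>" using C(1,2) unfolding A_def by auto
  have "AE \<omega> in M. (INF X\<in>A. X \<omega>) \<le> X \<omega>" if X: "X \<in> \<Phi>" for X
  proof -
    have "AE \<omega> in M. \<forall>q. \<omega> \<notin> L q X - (\<Union>X'\<in>C q. L q X')"
      unfolding AE_all_countable using AE_not_in[OF C(3)[OF X]] by blast
    with AE_space show ?thesis
    proof eventually_elim
      case (elim \<omega>)
      show ?case
      proof (rule dense_ge)
        \<comment> \<open>A rational \<open>q\<close> between \<open>X \<omega>\<close> and
          \<open>y\<close> puts \<open>\<omega>\<close> into \<open>L q X\<close>; outside the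
          exceptional null sets, some \<open>X'\<close> in \<open>C q\<close> is then below
          \<open>q\<close> at \<open>\<omega>\<close> as well.\<close>
        fix y assume "X \<omega> < y"
        then obtain r s where rs: "X \<omega> < ereal r" "r < s" "ereal s < y"
          by (metis ereal_dense2 ereal_less(2) less_ereal.simps(1))
        then obtain q where "r < real_of_rat q" "real_of_rat q < s"
          using of_rat_dense by auto
        then have q: "X \<omega> < ereal (real_of_rat q)" "ereal (real_of_rat q) < y"
          using rs by (metis less_ereal.simps(1) less_trans)+
        then obtain X' where "X' \<in> C q" "X' \<omega> < ereal (real_of_rat q)"
          using elim unfolding L_def by auto
        then show "(INF X\<in>A. X \<omega>) \<le> y"
          using q(2) by (intro INF_lower2[of X']) (auto simp: A_def)
      qed
    qed
  qed
  moreover have "(\<lambda>\<omega>. INF X\<in>A. X \<omega>) \<in> borel_measurable M"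
    using A \<Phi> by (intro borel_measurable_INF) auto
  ultimately have "AE \<omega> in M. (INF X\<in>A. X \<omega>) \<le> Y \<omega>"
    using Y unfolding is_ess_inf_def by simp
  moreover have "AE \<omega> in M. \<forall>X\<in>A. Y \<omega> \<le> X \<omega>"
    using Y A by (subst AE_ball_countable) (auto simp: is_ess_inf_def)
  ultimately have "AE \<omega> in M. (INF X\<in>A. X \<omega>) = Y \<omega>"
    by eventually_elim (auto intro!: antisym INF_greatest)
  with A that show thesis by blast
qed

lemma is_ess_inf_lower: "is_ess_inf M \<Phi> Y \<Longrightarrow> X \<in> \<Phi> \<Longrightarrow> AE \<omega> in M. Y \<omega> \<le> X \<omega>"
  by (simp add: is_ess_inf_def)

lemma is_ess_inf_greatest:
  assumes "is_ess_inf M \<Phi> Y" "Z \<in> borel_measurable M" "\<And>X. X \<in> \<Phi> \<Longrightarrow> AE \<omega> in M. Z \<omega> \<le> X \<omega>"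
  shows "AE \<omega> in M. Z \<omega> \<le> Y \<omega>"
  using assms by (simp add: is_ess_inf_def)

lemma is_ess_inf_measurable: "is_ess_inf M \<Phi> Y \<Longrightarrow> Y \<in> borel_measurable M"
  by (simp add: is_ess_inf_def)

section \<open>Supermartingales under loss constraints\<close>

text \<open>\<open>S\<close> enters as an adapted, \<open>Q\<close>-integrable process instead of
  through its increments; the theorem derives both properties from \<open>p\<close>.\<close>

locale constrained_setting =
  fixes P Q :: "'a measure"
    and F :: "nat \<Rightarrow> 'a measure"
    and S :: "nat \<Rightarrow> 'a \<Rightarrow> real"
    and l :: "real \<Rightarrow> real"
    and \<alpha> :: "nat \<Rightarrow> real"
    and n :: nat
  assumes prob_P: "prob_space P" and prob_Q: "prob_space Q"
    and sets_eq: "sets Q = sets P"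
    and ac_PQ: "absolutely_continuous P Q" and ac_QP: "absolutely_continuous Q P"
    and subalg_P: "\<And>i. i \<le> n \<Longrightarrow> subalgebra P (F i)"
    and filtration: "\<And>i j. i \<le> j \<Longrightarrow> j \<le> n \<Longrightarrow> sets (F i) \<subseteq> sets (F j)"
    and S_adapted: "\<And>t. t \<le> n \<Longrightarrow> S t \<in> borel_measurable (F t)"
    and S_integrable: "\<And>t. t \<le> n \<Longrightarrow> integrable Q (S t)"
    and antimono_l: "antimono l" and bdd_l: "bdd_below (range l)"
begin

section \<open>Passing between the equivalent measures and along the filtration\<close>

sublocale P: prob_space P by (rule prob_P)
sublocale Q: prob_space Q by (rule prob_Q)

lemma AE_P_iff_Q: "(AE \<omega> in P. \<phi> \<omega>) \<longleftrightarrow> (AE \<omega> in Q. \<phi> \<omega>)"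
  using absolutely_continuous_AE[OF sets_eq ac_PQ] absolutely_continuous_AE[OF sets_eq[symmetric] ac_QP]
  by blast

lemma measurable_P_eq_Q: "borel_measurable P = borel_measurable Q"
  by (rule measurable_cong_sets) (auto simp: sets_eq)

lemma subalg_Q: "i \<le> n \<Longrightarrow> subalgebra Q (F i)"
  using subalg_P sets_eq sets_eq_imp_space_eq[OF sets_eq] by (auto simp: subalgebra_def)

lemma subalg_F: "i \<le> j \<Longrightarrow> j \<le> n \<Longrightarrow> subalgebra (F j) (F i)"
  using subalg_P[of i] subalg_P[of j] filtration[of i j] by (auto simp: subalgebra_def)

lemma sigma_finite_P: "i \<le> n \<Longrightarrow> sigma_finite_subalgebra P (F i)"
  by (intro finite_measure_subalgebra_is_sigma_finite finite_measure_subalgebra.intro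
      finite_measure_subalgebra_axioms.intro P.finite_measure_axioms subalg_P)

lemma sigma_finite_Q: "i \<le> n \<Longrightarrow> sigma_finite_subalgebra Q (F i)"
  by (intro finite_measure_subalgebra_is_sigma_finite finite_measure_subalgebra.intro
      finite_measure_subalgebra_axioms.intro Q.finite_measure_axioms subalg_Q)

lemma measurable_F_P: "f \<in> measurable (F i) N \<Longrightarrow> i \<le> n \<Longrightarrow> f \<in> measurable P N"
  using measurable_from_subalg[OF subalg_P] by blast

lemma measurable_F_Q: "f \<in> measurable (F i) N \<Longrightarrow> i \<le> n \<Longrightarrow> f \<in> measurable Q N"
  using measurable_from_subalg[OF subalg_Q] by blast

lemma measurable_l [measurable]: "l \<in> borel_measurable borel"
proof -
  have "mono (\<lambda>x. - l x)" using antimono_l by (auto simp: mono_def antimono_def)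
  then have "(\<lambda>x. - l x) \<in> borel_measurable borel" by (rule borel_measurable_mono)
  then show ?thesis by simp
qed

section \<open>Stability and feasibility of the loss constraint\<close>

lemma measurable_loss:
  assumes "X \<in> borel_measurable (F t)" "t \<le> n"
  shows "(\<lambda>x. l (X x - S t x)) \<in> borel_measurable P"
proof -
  have [measurable]: "X \<in> borel_measurable P" "S t \<in> borel_measurable P"
    using assms S_adapted measurable_F_P by blast+
  show ?thesis by measurable
qed

text \<open>As \<open>l\<close> is decreasing, a larger variable has a smaller loss. This keeps the
  maximum of a competitor with other variables admissible.\<close>

lemma loss_constraint_mono:
  assumes "loss_constraint P F S l \<alpha> t X" "AE \<omega> in P. X \<omega> \<le> Y \<omega>" "t \<le> n"
    and "X \<in> borel_measurable (F t)" "Y \<in> borel_measurable (F t)"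
  shows "loss_constraint P F S l \<alpha> t Y"
proof -
  interpret G: sigma_finite_subalgebra P "F (t - 1)" using sigma_finite_P[of "t - 1"] assms(3) by simp
  have "AE \<omega> in P. ext_cond_exp P (F (t - 1)) (\<lambda>x. l (Y x - S t x)) \<omega>
      \<le> ext_cond_exp P (F (t - 1)) (\<lambda>x. l (X x - S t x)) \<omega>"
    using assms(2)
    by (intro G.ext_cond_exp_mono measurable_loss assms) (auto elim!: eventually_mono intro: antimonoD[OF antimono_l])
  with assms(1) show ?thesis unfolding loss_constraint_def by eventually_elim (rule order_trans)
qed

text \<open>The constraint at \<open>t\<close> is conditional on \<open>F (t - 1)\<close>, so it can
  be checked separately on \<open>A\<close> and on its complement, provided that \<open>A\<close> is
  known at time \<open>t - 1\<close>.\<close>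

lemma loss_constraint_paste:
  assumes X: "loss_constraint P F S l \<alpha> t X" and Y: "loss_constraint P F S l \<alpha> t Y" and t: "t \<le> n"
    and meas: "X \<in> borel_measurable (F t)" "Y \<in> borel_measurable (F t)"
    and A: "A \<in> sets (F (t - 1))"
  shows "loss_constraint P F S l \<alpha> t (\<lambda>x. if x \<in> A then X x else Y x)"
proof -
  interpret G: sigma_finite_subalgebra P "F (t - 1)" using sigma_finite_P[of "t - 1"] t by simp
  let ?Z = "\<lambda>x. if x \<in> A then X x else Y x"
  have sp: "space (F (t - 1)) = space P" using G.subalg by (simp add: subalgebra_def)
  have "A \<in> sets (F t)" using filtration[of "t - 1" t] t A by auto
  then have Z: "?Z \<in> borel_measurable (F t)" using meas by measurable
  have "AE \<omega> in P. \<omega> \<in> A \<longrightarrow> ext_cond_exp P (F (t - 1)) (\<lambda>x. l (?Z x - S t x)) \<omega>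
      = ext_cond_exp P (F (t - 1)) (\<lambda>x. l (X x - S t x)) \<omega>"
    by (intro G.ext_cond_exp_local A measurable_loss meas Z t) auto
  moreover have "AE \<omega> in P. \<omega> \<in> space (F (t - 1)) - A \<longrightarrow> ext_cond_exp P (F (t - 1)) (\<lambda>x. l (?Z x - S t x)) \<omega>
      = ext_cond_exp P (F (t - 1)) (\<lambda>x. l (Y x - S t x)) \<omega>"
    by (intro G.ext_cond_exp_local sets.compl_sets A measurable_loss meas Z t) auto
  ultimately show ?thesis using X Y AE_space unfolding loss_constraint_def sp
  proof eventually_elim
    case (elim \<omega>)
    then show ?case by (cases "\<omega> \<in> A") simp_all
  qed
qed

lemma loss_constraint_shift:
  assumes "l c \<le> \<alpha> t" "t \<le> n"
  shows "loss_constraint P F S l \<alpha> t (\<lambda>x. S t x + c)"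
proof -
  interpret G: sigma_finite_subalgebra P "F (t - 1)" using sigma_finite_P[of "t - 1"] assms(2) by simp
  have "AE x in P. ext_cond_exp P (F (t - 1)) (\<lambda>x. l c) x = ereal (real_cond_exp P (F (t - 1)) (\<lambda>x. l c) x)"
    by (intro G.ext_cond_exp_integrable) simp
  moreover have "AE x in P. real_cond_exp P (F (t - 1)) (\<lambda>x. l c) x = l c"
    by (intro G.real_cond_exp_F_meas) auto
  ultimately show ?thesis unfolding loss_constraint_def
    using assms(1) by (auto elim!: eventually_elim2)
qed

text \<open>If \<open>l\<close> stayed strictly above \<open>\<alpha> t\<close>, so would the loss
  of \<open>X\<close> at every point, and its conditional expectation could not be at most
  \<open>\<alpha> t\<close>.\<close>

lemma loss_constraint_feasible:
  assumes X: "loss_constraint P F S l \<alpha> t X" and t: "t \<le> n" and meas: "X \<in> borel_measurable (F t)"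
  obtains c where "l c \<le> \<alpha> t"
proof (rule ccontr)
  assume "\<not> thesis"
  then have gt: "\<alpha> t < l c" for c using that[of c] by linarith
  interpret G: sigma_finite_subalgebra P "F (t - 1)" using sigma_finite_P[of "t - 1"] t by simp
  \<comment> \<open>Cutting the loss off at \<open>\<alpha> t + 1\<close> makes it bounded, hence
    integrable, while it remains strictly above \<open>\<alpha> t\<close>.\<close>
  let ?f = "\<lambda>x. l (X x - S t x)" and ?g = "\<lambda>x. min (l (X x - S t x)) (\<alpha> t + 1)"
  note [measurable] = measurable_loss[OF meas t]
  have "integrable P ?g"
    using gt by (intro P.integrable_const_bound[where B = "\<bar>\<alpha> t\<bar> + 1"] AE_I2)
      (auto simp: abs_le_iff min_def intro: order_trans[OF _ less_imp_le[OF gt]] , smt (verit) gt)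
  then have "AE x in P. ext_cond_exp P (F (t - 1)) ?g x = ereal (real_cond_exp P (F (t - 1)) ?g x)"
    "AE x in P. \<alpha> t < real_cond_exp P (F (t - 1)) ?g x"
    using gt by (auto intro: G.ext_cond_exp_integrable G.real_cond_exp_gr_c simp del: One_nat_def)
  moreover have "AE x in P. ext_cond_exp P (F (t - 1)) ?g x \<le> ext_cond_exp P (F (t - 1)) ?f x"
    by (intro G.ext_cond_exp_mono) auto
  moreover note X[unfolded loss_constraint_def]
  ultimately have "AE x in P. False"
  proof eventually_elim
    case (elim x)
    have "ereal (real_cond_exp P (F (t - 1)) ?g x) \<le> ereal (\<alpha> t)"
      using order_trans[OF elim(3,4)] unfolding elim(1) .
    with elim(2) show ?case by simp
  qed
  then show False by simp
qed

section \<open>Restricting, pasting and extending admissible supermartingales\<close>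

abbreviation TC where "TC \<equiv> M_TC P Q F S l \<alpha> n"

lemma TC_iff:
  "M \<in> TC k \<longleftrightarrow> (\<forall>t\<in>{k..n}. M t \<in> borel_measurable (F t) \<and> integrable Q (M t)) \<and>
     (\<forall>s t. k \<le> s \<longrightarrow> s \<le> t \<longrightarrow> t \<le> n \<longrightarrow> (AE \<omega> in Q. real_cond_exp Q (F s) (M t) \<omega> \<le> M s \<omega>)) \<and>
     (\<forall>t\<in>{k+1..n}. loss_constraint P F S l \<alpha> t (M t))"
  unfolding M_TC_def supermartingale_def by (auto dest: order_trans)

lemma TC_tail: "M \<in> TC k \<Longrightarrow> k \<le> j \<Longrightarrow> M \<in> TC j"
  unfolding TC_iff by auto

text \<open>The comparison of \<open>M k\<close> and \<open>N k\<close> is decided at time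
  \<open>k\<close>, so following the process with the smaller initial value is a choice along a set
  in every \<open>F s\<close> with \<open>s \<ge> k\<close>. Both the supermartingale inequalities
  and the constraints after \<open>k\<close> localise to such a set.\<close>

lemma TC_min:
  assumes M: "M \<in> TC k" and N: "N \<in> TC k" and k: "k \<le> n"
  shows "\<exists>L\<in>TC k. \<forall>\<omega>\<in>space P. L k \<omega> = min (M k \<omega>) (N k \<omega>)"
proof -
  define A where "A = {\<omega> \<in> space (F k). M k \<omega> \<le> N k \<omega>}"
  define L where "L t \<omega> = (if \<omega> \<in> A then M t \<omega> else N t \<omega>)" for t \<omega>
  have "M k \<in> borel_measurable (F k)" "N k \<in> borel_measurable (F k)" using M N k by (auto simp: TC_iff)
  then have "A \<in> sets (F k)" unfolding A_def by measurable
  then have A: "A \<in> sets (F t)" if "k \<le> t" "t \<le> n" for t using filtration that by blast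
  have meas: "M t \<in> borel_measurable (F t)" "N t \<in> borel_measurable (F t)" "L t \<in> borel_measurable (F t)"
    and int: "integrable Q (M t)" "integrable Q (N t)" "integrable Q (L t)" if t: "k \<le> t" "t \<le> n" for t
  proof -
    show m: "M t \<in> borel_measurable (F t)" "N t \<in> borel_measurable (F t)"
      and i: "integrable Q (M t)" "integrable Q (N t)" using M N t by (auto simp: TC_iff)
    show l: "L t \<in> borel_measurable (F t)" unfolding L_def using m A[OF t] by measurable
    show "integrable Q (L t)"
      by (rule Bochner_Integration.integrable_bound[of _ "\<lambda>\<omega>. \<bar>M t \<omega>\<bar> + \<bar>N t \<omega>\<bar>"])
        (use i l measurable_F_Q t in \<open>auto simp: L_def\<close>)
  qed
  have "AE \<omega> in Q. real_cond_exp Q (F s) (L t) \<omega> \<le> L s \<omega>" if st: "k \<le> s" "s \<le> t" "t \<le> n" for s t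
  proof -
    interpret G: sigma_finite_subalgebra Q "F s" using sigma_finite_Q st by simp
    have sp: "space (F s) = space Q" using G.subalg by (simp add: subalgebra_def)
    have tt: "k \<le> t" using st by simp
    note mQ = measurable_F_Q[OF meas(1)[OF tt st(3)] st(3)] measurable_F_Q[OF meas(2)[OF tt st(3)] st(3)]
      measurable_F_Q[OF meas(3)[OF tt st(3)] st(3)]
    have As: "A \<in> sets (F s)" using A st by simp
    \<comment> \<open>Localisation is available for \<open>ext_cond_exp\<close>; since all variables
      are integrable, the extended values are then read as real conditional expectations.\<close>
    have "AE \<omega> in Q. \<omega> \<in> A \<longrightarrow> ext_cond_exp Q (F s) (L t) \<omega> = ext_cond_exp Q (F s) (M t) \<omega>"
      by (intro G.ext_cond_exp_local As mQ) (auto simp: L_def)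
    moreover have "AE \<omega> in Q. \<omega> \<in> space (F s) - A \<longrightarrow> ext_cond_exp Q (F s) (L t) \<omega> = ext_cond_exp Q (F s) (N t) \<omega>"
      by (intro G.ext_cond_exp_local sets.compl_sets As mQ) (auto simp: L_def)
    moreover have "AE \<omega> in Q. real_cond_exp Q (F s) (M t) \<omega> \<le> M s \<omega>" "AE \<omega> in Q. real_cond_exp Q (F s) (N t) \<omega> \<le> N s \<omega>"
      using M N st by (auto simp: TC_iff)
    moreover note AE_space
      G.ext_cond_exp_integrable[OF int(1)[OF tt st(3)]] G.ext_cond_exp_integrable[OF int(2)[OF tt st(3)]]
      G.ext_cond_exp_integrable[OF int(3)[OF tt st(3)]]
    ultimately show ?thesis unfolding sp
      by eventually_elim (auto simp: L_def split: if_splits)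
  qed
  moreover have "loss_constraint P F S l \<alpha> t (L t)" if t: "t \<in> {k+1..n}" for t
    unfolding L_def using t M N A[of "t - 1"] meas[of t]
    by (intro loss_constraint_paste) (auto simp: TC_iff)
  ultimately have "L \<in> TC k" using meas int by (auto simp: TC_iff)
  moreover have "\<forall>\<omega>\<in>space P. L k \<omega> = min (M k \<omega>) (N k \<omega>)"
    using subalg_P[OF k] by (auto simp: L_def A_def subalgebra_def)
  ultimately show ?thesis by blast
qed

text \<open>Raising the initial value is harmless: for later \<open>t\<close> the conditional
  expectation of \<open>N t\<close> given \<open>F k\<close> is at most \<open>N k \<le> X\<close>.
  The conditional expectation of \<open>X\<close> is then the smallest possible value one step
  earlier.\<close>

lemma TC_cons:
  assumes N: "N \<in> TC k" and k: "1 \<le> k" "k \<le> n" and X: "X \<in> borel_measurable (F k)" "integrable Q X"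
    and le: "AE \<omega> in Q. N k \<omega> \<le> X \<omega>" and loss: "loss_constraint P F S l \<alpha> k X"
  shows "\<exists>L\<in>TC (k - 1). L (k - 1) = real_cond_exp Q (F (k - 1)) X"
proof -
  \<comment> \<open>Of the indices below \<open>k\<close> only \<open>k - 1\<close> belongs to the
    index set of \<open>TC (k - 1)\<close>; \<open>1 \<le> k\<close> makes it differ from
    \<open>k\<close>.\<close>
  define L where "L t = (if t < k then real_cond_exp Q (F (k - 1)) X else if t = k then X else N t)" for t
  interpret G: sigma_finite_subalgebra Q "F (k - 1)" using sigma_finite_Q[of "k - 1"] k by simp
  have N': "N t \<in> borel_measurable (F t)" "integrable Q (N t)" if "k \<le> t" "t \<le> n" for t
    using N that by (auto simp: TC_iff)
  have L: "L t \<in> borel_measurable (F t)" "integrable Q (L t)" if "k - 1 \<le> t" "t \<le> n" for t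
  proof -
    have "L t \<in> borel_measurable (F t) \<and> integrable Q (L t)"
    proof (cases "t < k")
      case True
      then have "t = k - 1" using that by simp
      then show ?thesis using True G.real_cond_exp_int(1)[OF X(2)] by (simp add: L_def)
    next
      case False
      then show ?thesis using X N'[of t] that by (cases "t = k") (simp_all add: L_def)
    qed
    then show "L t \<in> borel_measurable (F t)" "integrable Q (L t)" by auto
  qed
  have from_k: "AE \<omega> in Q. real_cond_exp Q (F k) (L t) \<omega> \<le> X \<omega>" if t: "k \<le> t" "t \<le> n" for t
  proof (cases "t = k")
    case True
    interpret H: sigma_finite_subalgebra Q "F k" using sigma_finite_Q k by simp
    show ?thesis using H.real_cond_exp_F_meas[OF X(2,1)] True by (auto simp: L_def)
  next
    case False
    have "AE \<omega> in Q. real_cond_exp Q (F k) (N t) \<omega> \<le> N k \<omega>" using N t by (auto simp: TC_iff)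
    with le show ?thesis using False t by (auto simp: L_def elim!: eventually_elim2)
  qed
  have "AE \<omega> in Q. real_cond_exp Q (F s) (L t) \<omega> \<le> L s \<omega>" if st: "k - 1 \<le> s" "s \<le> t" "t \<le> n" for s t
  proof -
    consider "s = k - 1" "t = k - 1" | "s = k - 1" "k \<le> t" | "s = k" "k \<le> t" | "k < s" using st by linarith
    then show ?thesis
    proof cases
      case 1
      then have "AE \<omega> in Q. real_cond_exp Q (F (k - 1)) (L (k - 1)) \<omega> = L (k - 1) \<omega>"
        using k by (intro G.real_cond_exp_F_meas L) auto
      with 1 show ?thesis by auto
    next
      \<comment> \<open>Tower property: conditioning on \<open>F k\<close> first gives something
        below \<open>X\<close> by \<open>from_k\<close>, and conditioning that on
        \<open>F (k - 1)\<close> gives something below \<open>L (k - 1)\<close>.\<close>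
      case 2
      interpret H: sigma_finite_subalgebra Q "F k" using sigma_finite_Q k by simp
      have "AE \<omega> in Q. real_cond_exp Q (F (k - 1)) (real_cond_exp Q (F k) (L t)) \<omega> = real_cond_exp Q (F (k - 1)) (L t) \<omega>"
        using subalg_Q subalg_F L(2)[of t] 2 st k by (intro G.real_cond_exp_nested_subalg) auto
      moreover have "AE \<omega> in Q. real_cond_exp Q (F (k - 1)) (real_cond_exp Q (F k) (L t)) \<omega> \<le> real_cond_exp Q (F (k - 1)) X \<omega>"
        using from_k[of t] L(2)[of t] 2 st k X by (intro G.real_cond_exp_mono H.real_cond_exp_int(1)) auto
      ultimately show ?thesis using 2 k by (auto simp: L_def elim!: eventually_elim2)
    next
      case 3
      then show ?thesis using from_k st by (auto simp: L_def[of k])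
    next
      case 4
      then show ?thesis using N st by (auto simp: TC_iff L_def)
    qed
  qed
  \<comment> \<open>Starting at \<open>k - 1\<close> instead of \<open>k\<close> adds exactly one
    constraint, the one at \<open>k\<close>, and there the process equals \<open>X\<close>.\<close>
  moreover have "loss_constraint P F S l \<alpha> t (L t)" if "t \<in> {k - 1 + 1..n}" for t
    using that k N loss by (cases "t = k") (auto simp: L_def TC_iff)
  ultimately have "L \<in> TC (k - 1)" using L by (auto simp: TC_iff)
  then show ?thesis using k by (intro bexI[of _ L]) (auto simp: L_def)
qed

section \<open>Approximating a competitor from above\<close>

lemma TC_values_measurable:
  assumes "k \<le> n"
  shows "{\<lambda>\<omega>. ereal (N k \<omega>) | N. N \<in> TC k} \<subseteq> borel_measurable P"
  using assms by (auto simp: TC_iff intro!: borel_measurable_ereal measurable_F_P)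

text \<open>A countable subfamily realises \<open>U\<close>, and its running minima are again values
  of admissible processes. The conclusion is phrased through \<open>M\<close> because
  \<open>U\<close> may be \<open>-\<infinity>\<close>, and later only convergence down to
  \<open>M\<close> matters.\<close>

lemma TC_attain:
  assumes U: "is_ess_inf P {\<lambda>\<omega>. ereal (N k \<omega>) | N. N \<in> TC k} U" and k: "k \<le> n"
    and M: "AE \<omega> in P. U \<omega> \<le> ereal (M \<omega>)"
  shows "\<exists>N. (\<forall>j. N j \<in> TC k) \<and> (\<forall>\<omega>\<in>space P. decseq (\<lambda>j. N j k \<omega>)) \<and>
    (AE \<omega> in P. \<forall>r > M \<omega>. \<exists>j. N j k \<omega> < r)"
proof -
  from P.is_ess_inf_countable[OF TC_values_measurable[OF k] U] obtain C where
    C: "countable C" "C \<subseteq> {\<lambda>\<omega>. ereal (N k \<omega>) | N. N \<in> TC k}" "AE \<omega> in P. (INF X\<in>C. X \<omega>) = U \<omega>" by blast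
  \<comment> \<open>The infimum over an empty family would be \<open>\<infinity>\<close>,
    contradicting the real-valued upper bound \<open>M\<close> of \<open>U\<close>. This is also the
    source of the nonemptiness of \<open>TC k\<close>.\<close>
  have "C \<noteq> {}"
  proof
    assume "C = {}"
    with C(3) have "AE \<omega> in P. \<infinity> = U \<omega>" by (simp add: top_ereal_def)
    with M have "AE \<omega> in P. False" by eventually_elim auto
    then show False by simp
  qed
  have "\<forall>j. \<exists>N\<in>TC k. from_nat_into C j = (\<lambda>\<omega>. ereal (N k \<omega>))"
    using C(2) from_nat_into[OF \<open>C \<noteq> {}\<close>] by blast
  then obtain c where c: "\<And>j. c j \<in> TC k" "\<And>j. from_nat_into C j = (\<lambda>\<omega>. ereal (c j k \<omega>))" by metis
  have "\<exists>L\<in>TC k. \<forall>\<omega>\<in>space P. L k \<omega> = Min ((\<lambda>i. c i k \<omega>) ` {..j})" for j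
  proof (induction j)
    case 0
    show ?case using c(1)[of 0] by (intro bexI[of _ "c 0"]) auto
  next
    case (Suc j)
    then obtain L where L: "L \<in> TC k" "\<forall>\<omega>\<in>space P. L k \<omega> = Min ((\<lambda>i. c i k \<omega>) ` {..j})" by blast
    from TC_min[OF c(1) L(1) k, of "Suc j"] obtain L' where
      "L' \<in> TC k" "\<forall>\<omega>\<in>space P. L' k \<omega> = min (c (Suc j) k \<omega>) (L k \<omega>)" by blast
    then show ?case using L(2) by (intro bexI[of _ L']) (auto simp: atMost_Suc Min_insert)
  qed
  then obtain N where N: "\<And>j. N j \<in> TC k" "\<And>j \<omega>. \<omega> \<in> space P \<Longrightarrow> N j k \<omega> = Min ((\<lambda>i. c i k \<omega>) ` {..j})"
    by metis
  have "decseq (\<lambda>j. N j k \<omega>)" if "\<omega> \<in> space P" for \<omega>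
    unfolding N(2)[OF that] decseq_def by (intro allI impI Min_antimono image_mono) auto
  moreover have "AE \<omega> in P. \<forall>r > M \<omega>. \<exists>j. N j k \<omega> < r"
    using C(3) M AE_space
  proof eventually_elim
    case (elim \<omega>)
    show ?case
    proof (intro allI impI)
      fix r assume "M \<omega> < r"
      with elim have "(INF X\<in>C. X \<omega>) < ereal r" by (metis less_ereal.simps(1) order_le_less_trans)
      then obtain X where X: "X \<in> C" "X \<omega> < ereal r" by (auto simp: INF_less_iff)
      then obtain j where "from_nat_into C j = X" using from_nat_into_surj[OF C(1)] by blast
      with X c(2)[of j] have "c j k \<omega> < r" by auto
      moreover have "N j k \<omega> \<le> c j k \<omega>" unfolding N(2)[OF elim(3)] by (intro Min_le) auto
      ultimately show "\<exists>j. N j k \<omega> < r" by (intro exI[of _ j]) simp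
    qed
  qed
  ultimately show ?thesis using N(1) by (intro exI[of _ N]) simp
qed

text \<open>\<open>Z\<close> is any lower bound of the values at \<open>k - 1\<close>; in the end it
  is their essential infimum. Finiteness of the positive part of \<open>M\<close> under
  \<open>Q\<close> yields integrability of the approximating variables, as \<open>TC_cons\<close>
  demands.\<close>

lemma TC_lower_bound_le_integrable_pos:
  assumes U: "is_ess_inf P {\<lambda>\<omega>. ereal (N k \<omega>) | N. N \<in> TC k} U" and k: "1 \<le> k" "k \<le> n"
    and Z: "\<And>L. L \<in> TC (k - 1) \<Longrightarrow> AE \<omega> in P. Z \<omega> \<le> ereal (L (k - 1) \<omega>)"
    and M: "M \<in> borel_measurable (F k)" "AE \<omega> in P. U \<omega> \<le> ereal (M \<omega>)" "loss_constraint P F S l \<alpha> k M"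
    and fin: "(\<integral>\<^sup>+\<omega>. ennreal (M \<omega>) \<partial>Q) < \<infinity>"
  shows "AE \<omega> in P. Z \<omega> \<le> ext_cond_exp Q (F (k - 1)) M \<omega>"
proof -
  interpret G: sigma_finite_subalgebra Q "F (k - 1)" using sigma_finite_Q[of "k - 1"] k by simp
  from TC_attain[OF U k(2) M(2)] obtain N where N0: "\<forall>j. N j \<in> TC k"
    "\<forall>\<omega>\<in>space P. decseq (\<lambda>j. N j k \<omega>)" "AE \<omega> in P. \<forall>r > M \<omega>. \<exists>j. N j k \<omega> < r"
    by (elim exE conjE)
  have N: "N j \<in> TC k" "i \<le> j \<Longrightarrow> \<omega> \<in> space P \<Longrightarrow> N j k \<omega> \<le> N i k \<omega>" for i j \<omega>
    using N0(1,2) by (auto dest: decseqD)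
  \<comment> \<open>The value 0 off \<open>space P\<close> is there because \<open>N j k\<close> is
    known to decrease only on \<open>space P\<close>, whereas \<open>decseq X\<close> speaks of all
    points.\<close>
  define X where "X j \<omega> = (if \<omega> \<in> space P then max (M \<omega>) (max (N j k \<omega>) (- real j)) else 0)" for j \<omega>
  have spF: "space (F k) = space P" using subalg_P[OF k(2)] by (simp add: subalgebra_def)
  have N': "N j k \<in> borel_measurable (F k)" "integrable Q (N j k)" for j
    using N(1)[of j] k by (auto simp: TC_iff)
  have Xm: "X j \<in> borel_measurable (F k)" for j
  proof -
    have "(\<lambda>\<omega>. max (M \<omega>) (max (N j k \<omega>) (- real j))) \<in> borel_measurable (F k)"
      using M(1) N'(1)[of j] by measurable
    then show ?thesis by (rule measurable_cong[THEN iffD1, rotated]) (simp add: X_def spF)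
  qed
  note MQ = measurable_F_Q[OF M(1) k(2)]
  have "integrable Q (\<lambda>\<omega>. max (M \<omega>) 0)"
  proof (rule integrableI_nonneg)
    have "(\<integral>\<^sup>+\<omega>. ennreal (max (M \<omega>) 0) \<partial>Q) = (\<integral>\<^sup>+\<omega>. ennreal (M \<omega>) \<partial>Q)"
      by (intro nn_integral_cong) (auto simp: max_def ennreal_neg)
    with fin show "(\<integral>\<^sup>+\<omega>. ennreal (max (M \<omega>) 0) \<partial>Q) < \<infinity>" by simp
  qed (use MQ in auto)
  \<comment> \<open>This dominates \<open>X j\<close> in absolute value: \<open>max M 0\<close> and
    the absolute value of \<open>N j k\<close> bound it from above, and the floor \<open>- j\<close>
    bounds it from below.\<close>
  then have dom: "integrable Q (\<lambda>\<omega>. max (M \<omega>) 0 + \<bar>N j k \<omega>\<bar> + real j)" for j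
    using N'(2)[of j] by auto
  have Xi: "integrable Q (X j)" for j
    by (rule Bochner_Integration.integrable_bound[OF dom[of j]])
      (use measurable_F_Q[OF Xm k(2)] in \<open>auto simp: X_def max_def\<close>)
  have bound: "AE \<omega> in Q. Z \<omega> \<le> ereal (real_cond_exp Q (F (k - 1)) (X j) \<omega>)" for j
  proof -
    have "AE \<omega> in Q. N j k \<omega> \<le> X j \<omega>" "AE \<omega> in P. M \<omega> \<le> X j \<omega>"
      using sets_eq_imp_space_eq[OF sets_eq] by (auto simp: X_def intro!: AE_I2)
    from TC_cons[OF N(1) k Xm Xi this(1) loss_constraint_mono[OF M(3) this(2) k(2) M(1) Xm]]
    obtain L where "L \<in> TC (k - 1)" "L (k - 1) = real_cond_exp Q (F (k - 1)) (X j)" by blast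
    with Z[of L] show ?thesis by (simp add: AE_P_iff_Q)
  qed
  have "AE \<omega> in Q. (\<lambda>j. X j \<omega>) \<longlonglongrightarrow> M \<omega>"
    unfolding AE_P_iff_Q[symmetric] using N0(3) AE_space
  proof eventually_elim
    case (elim \<omega>)
    show ?case
    proof (rule order_tendstoI)
      fix a assume "a < M \<omega>"
      then show "\<forall>\<^sub>F j in sequentially. a < X j \<omega>" using elim by (simp add: X_def less_max_iff_disj)
    next
      fix a assume a: "M \<omega> < a"
      then obtain i where i: "N i k \<omega> < a" using elim by blast
      obtain m :: nat where m: "- a < real m" using reals_Archimedean2 by blast
      \<comment> \<open>From this index on, all three entries of the maximum are below
        \<open>a\<close>: \<open>M \<omega>\<close> by choice of \<open>a\<close>,
        \<open>N j k \<omega>\<close> by monotonicity from \<open>i\<close>, and \<open>- j\<close>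
        by choice of \<open>m\<close>.\<close>
      have "X j \<omega> < a" if "max i m \<le> j" for j
        using N(2)[of i j \<omega>] i m a that elim by (simp add: X_def)
      then show "\<forall>\<^sub>F j in sequentially. X j \<omega> < a" unfolding eventually_sequentially by blast
    qed
  qed
  moreover have "decseq X"
  proof -
    have "X j \<omega> \<le> X i \<omega>" if "i \<le> j" for i j \<omega>
      unfolding X_def using N(2)[of i j \<omega>] that by (auto intro!: max.mono[OF order_refl])
    then show ?thesis unfolding decseq_def by (simp add: le_fun_def)
  qed
  ultimately show ?thesis
    unfolding AE_P_iff_Q by (intro G.le_ext_cond_exp_decseq[OF Xi MQ _ _ bound])
qed

text \<open>
  Where the conditional expectation of the positive part of \<open>M\<close> exceeds \<open>b\<close>, \<open>M\<close> is replaced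
  by an integrable admissible variable; that \<open>M\<close> is admissible at all provides a level \<open>c\<close>
  for which \<open>S k + c\<close> satisfies the loss constraint.
\<close>

lemma TC_lower_bound_le:
  assumes U: "is_ess_inf P {\<lambda>\<omega>. ereal (N k \<omega>) | N. N \<in> TC k} U" and k: "1 \<le> k" "k \<le> n"
    and Z: "\<And>L. L \<in> TC (k - 1) \<Longrightarrow> AE \<omega> in P. Z \<omega> \<le> ereal (L (k - 1) \<omega>)"
    and M: "M \<in> borel_measurable (F k)" "AE \<omega> in P. U \<omega> \<le> ereal (M \<omega>)" "loss_constraint P F S l \<alpha> k M"
  shows "AE \<omega> in P. Z \<omega> \<le> ext_cond_exp Q (F (k - 1)) M \<omega>"
proof -
  interpret G: sigma_finite_subalgebra Q "F (k - 1)" using sigma_finite_Q[of "k - 1"] k by simp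
  let ?E = "nn_cond_exp Q (F (k - 1)) (\<lambda>\<omega>. ennreal (M \<omega>))"
  have "TC k \<noteq> {}" using TC_attain[OF U k(2) M(2)] by (elim exE conjE) auto
  then obtain N where N: "N \<in> TC k" by blast
  obtain c where c: "l c \<le> \<alpha> k" using loss_constraint_feasible[OF M(3) k(2) M(1)] .
  \<comment> \<open>The two entries serve different conditions: \<open>N k\<close> keeps
    \<open>X\<close> above \<open>U\<close>, and \<open>S k + c\<close> makes it satisfy the loss
    constraint. Both are integrable.\<close>
  define X where "X \<omega> = max (N k \<omega>) (S k \<omega> + c)" for \<omega>
  have N': "N k \<in> borel_measurable (F k)" "integrable Q (N k)" using N k by (auto simp: TC_iff)
  have Sc: "(\<lambda>\<omega>. S k \<omega> + c) \<in> borel_measurable (F k)" using S_adapted[OF k(2)] by measurable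
  have Xm: "X \<in> borel_measurable (F k)" unfolding X_def using N' Sc by measurable
  have Xi: "integrable Q X" unfolding X_def using N' S_integrable[OF k(2)] by auto
  have Xl: "loss_constraint P F S l \<alpha> k X"
    by (rule loss_constraint_mono[OF loss_constraint_shift[OF c k(2)] _ k(2) Sc Xm]) (auto simp: X_def)
  have XU: "AE \<omega> in P. U \<omega> \<le> ereal (X \<omega>)"
  proof -
    have "AE \<omega> in P. U \<omega> \<le> ereal (N k \<omega>)" using is_ess_inf_lower[OF U, of "\<lambda>\<omega>. ereal (N k \<omega>)"] N by blast
    then show ?thesis by eventually_elim (auto simp: X_def intro: order_trans)
  qed
  have main: "AE \<omega> in P. ?E \<omega> \<le> of_nat b \<longrightarrow> Z \<omega> \<le> ext_cond_exp Q (F (k - 1)) M \<omega>" for b :: nat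
  proof -
    define B where "B = {\<omega> \<in> space (F (k - 1)). ?E \<omega> \<le> of_nat b}"
    define Y where "Y \<omega> = (if \<omega> \<in> B then M \<omega> else X \<omega>)" for \<omega>
    have sp: "space (F (k - 1)) = space Q" using G.subalg by (simp add: subalgebra_def)
    have B: "B \<in> sets (F (k - 1))" unfolding B_def by measurable
    then have Bk: "B \<in> sets (F k)" using filtration[of "k - 1" k] k by auto
    have Ym: "Y \<in> borel_measurable (F k)" unfolding Y_def using M(1) Xm Bk by measurable
    have mQ[measurable]: "M \<in> borel_measurable Q" "X \<in> borel_measurable Q" "Y \<in> borel_measurable Q"
      using measurable_F_Q M(1) Xm Ym k by blast+
    have "(\<integral>\<^sup>+\<omega>. ennreal (Y \<omega>) \<partial>Q) \<le> (\<integral>\<^sup>+\<omega>. indicator B \<omega> * ennreal (M \<omega>) + ennreal (norm (X \<omega>)) \<partial>Q)"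
      by (intro nn_integral_mono) (auto simp: Y_def indicator_def intro: ennreal_leI)
    also have "\<dots> = (\<integral>\<^sup>+\<omega>. indicator B \<omega> * ennreal (M \<omega>) \<partial>Q) + (\<integral>\<^sup>+\<omega>. ennreal (norm (X \<omega>)) \<partial>Q)"
    proof (rule nn_integral_add)
      have [measurable]: "B \<in> sets Q" using B G.subalg by (auto simp: subalgebra_def)
      show "(\<lambda>\<omega>. indicator B \<omega> * ennreal (M \<omega>)) \<in> borel_measurable Q" by measurable
    qed simp
    \<comment> \<open>As \<open>B\<close> lies in \<open>F (k - 1)\<close>, the positive part of
      \<open>M\<close> may be replaced by its conditional expectation, which is at most
      \<open>b\<close> on \<open>B\<close>.\<close>
    also have "(\<integral>\<^sup>+\<omega>. indicator B \<omega> * ennreal (M \<omega>) \<partial>Q) = (\<integral>\<^sup>+\<omega>. indicator B \<omega> * ?E \<omega> \<partial>Q)"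
      using B by (intro G.nn_cond_exp_intg[symmetric]) auto
    also have "\<dots> \<le> (\<integral>\<^sup>+\<omega>. of_nat b \<partial>Q)"
      by (intro nn_integral_mono) (auto simp: indicator_def B_def)
    also have "\<dots> = of_nat b" by (simp add: Q.emeasure_space_1)
    finally have "(\<integral>\<^sup>+\<omega>. ennreal (Y \<omega>) \<partial>Q) \<le> of_nat b + (\<integral>\<^sup>+\<omega>. ennreal (norm (X \<omega>)) \<partial>Q)"
      by (simp add: add_right_mono)
    also have "\<dots> < \<infinity>" using Xi by (simp add: integrable_iff_bounded of_nat_less_top)
    finally have fin: "(\<integral>\<^sup>+\<omega>. ennreal (Y \<omega>) \<partial>Q) < \<infinity>" .
    have "AE \<omega> in P. U \<omega> \<le> ereal (Y \<omega>)" using M(2) XU by eventually_elim (simp add: Y_def)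
    moreover have "loss_constraint P F S l \<alpha> k Y"
      unfolding Y_def by (intro loss_constraint_paste M Xl k Xm B)
    ultimately have "AE \<omega> in P. Z \<omega> \<le> ext_cond_exp Q (F (k - 1)) Y \<omega>"
      using fin by (intro TC_lower_bound_le_integrable_pos[OF U k _ Ym] Z)
    moreover have "AE \<omega> in Q. \<omega> \<in> B \<longrightarrow> ext_cond_exp Q (F (k - 1)) Y \<omega> = ext_cond_exp Q (F (k - 1)) M \<omega>"
      by (intro G.ext_cond_exp_local B mQ) (simp add: Y_def)
    ultimately show ?thesis unfolding AE_P_iff_Q using AE_space
      by eventually_elim (auto simp: B_def sp[simplified])
  qed
  then have "AE \<omega> in P. \<forall>b::nat. ?E \<omega> \<le> of_nat b \<longrightarrow> Z \<omega> \<le> ext_cond_exp Q (F (k - 1)) M \<omega>"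
    unfolding AE_all_countable by blast
  then show ?thesis
  proof eventually_elim
    case (elim \<omega>)
    show ?case
    proof (cases "?E \<omega> = \<infinity>")
      \<comment> \<open>Here the extended conditional expectation is \<open>\<infinity>\<close>,
        even where the negative part is infinite too, by the convention for
        \<open>\<infinity> - \<infinity>\<close>.\<close>
      case True
      then show ?thesis by (simp add: ext_cond_exp_def)
    next
      case False
      then have "?E \<omega> < top" by (simp add: less_top[symmetric])
      then obtain b :: nat where "?E \<omega> < of_nat b" using ennreal_Ex_less_of_nat by blast
      with elim[rule_format, of b] show ?thesis by simp
    qed
  qed
qed

section \<open>The backward recursion for the essential infima\<close>

lemma ess_inf_TC:
  assumes "k \<le> n"
  shows "is_ess_inf P {\<lambda>\<omega>. ereal (M k \<omega>) | M. M \<in> TC k} (ess_inf P {\<lambda>\<omega>. ereal (M k \<omega>) | M. M \<in> TC k})"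
  by (rule P.is_ess_inf_ess_inf[OF TC_values_measurable[OF assms]])

text \<open>At the final time the range \<open>{n+1..n}\<close> of the constraints is empty, so all
  constants are admissible, and the constants \<open>- m\<close> are unbounded below.\<close>

lemma ess_inf_TC_final: "AE \<omega> in P. ess_inf P {\<lambda>\<omega>. ereal (M n \<omega>) | M. M \<in> TC n} \<omega> = -\<infinity>"
proof -
  interpret H: sigma_finite_subalgebra Q "F n" using sigma_finite_Q by simp
  have const: "(\<lambda>_ _. r) \<in> TC n" for r :: real
  proof -
    have "AE \<omega> in Q. real_cond_exp Q (F n) (\<lambda>_. r) \<omega> = r" by (intro H.real_cond_exp_F_meas) auto
    then have "AE \<omega> in Q. real_cond_exp Q (F n) (\<lambda>_. r) \<omega> \<le> r" by eventually_elim simp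
    then show ?thesis unfolding TC_iff by (auto dest: antisym)
  qed
  have "\<forall>m::nat. AE \<omega> in P. ess_inf P {\<lambda>\<omega>. ereal (M n \<omega>) | M. M \<in> TC n} \<omega> \<le> ereal (- real m)"
  proof
    fix m :: nat
    have "(\<lambda>_. ereal (- real m)) \<in> {\<lambda>\<omega>. ereal (M n \<omega>) | M. M \<in> TC n}"
      by (intro CollectI exI[of _ "\<lambda>_ _. - real m"] conjI refl const)
    from is_ess_inf_lower[OF ess_inf_TC[of n] this]
    show "AE \<omega> in P. ess_inf P {\<lambda>\<omega>. ereal (M n \<omega>) | M. M \<in> TC n} \<omega> \<le> ereal (- real m)" by simp
  qed
  then have "AE \<omega> in P. \<forall>m::nat. ess_inf P {\<lambda>\<omega>. ereal (M n \<omega>) | M. M \<in> TC n} \<omega> \<le> ereal (- real m)"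
    unfolding AE_all_countable .
  then show ?thesis
  proof eventually_elim
    case (elim \<omega>)
    show ?case
    proof (rule ereal_bot)
      fix r :: real
      obtain m :: nat where "- r \<le> real m" using real_arch_simple by blast
      then show "ess_inf P {\<lambda>\<omega>. ereal (M n \<omega>) | M. M \<in> TC n} \<omega> \<le> ereal r"
        using elim[rule_format, of m] by (meson ereal_less_eq(3) minus_le_iff order_trans)
    qed
  qed
qed

text \<open>\<open>V\<close> is any version of the essential infimum at \<open>k\<close>, which is
  all that the induction can provide. Altering \<open>V\<close> on a null set leaves the almost sure
  condition on competitors unchanged.\<close>

lemma ess_inf_TC_step:
  assumes k: "1 \<le> k" "k \<le> n"
    and V: "AE \<omega> in P. V \<omega> = ess_inf P {\<lambda>\<omega>. ereal (M k \<omega>) | M. M \<in> TC k} \<omega>"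
  shows "AE \<omega> in P. ess_inf P {ext_cond_exp Q (F (k - 1)) M | M.
       M \<in> borel_measurable (F k) \<and> cond_exp_exists Q (F (k - 1)) M \<and>
       (AE \<omega> in P. V \<omega> \<le> ereal (M \<omega>)) \<and> loss_constraint P F S l \<alpha> k M} \<omega>
     = ess_inf P {\<lambda>\<omega>. ereal (M (k - 1) \<omega>) | M. M \<in> TC (k - 1)} \<omega>"
proof -
  interpret G: sigma_finite_subalgebra Q "F (k - 1)" using sigma_finite_Q[of "k - 1"] k by simp
  let ?U = "ess_inf P {\<lambda>\<omega>. ereal (M k \<omega>) | M. M \<in> TC k}"
  let ?W = "ess_inf P {\<lambda>\<omega>. ereal (M (k - 1) \<omega>) | M. M \<in> TC (k - 1)}"
  let ?A = "\<lambda>M. M \<in> borel_measurable (F k) \<and> cond_exp_exists Q (F (k - 1)) M \<and>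
       (AE \<omega> in P. V \<omega> \<le> ereal (M \<omega>)) \<and> loss_constraint P F S l \<alpha> k M"
  let ?\<Phi> = "{ext_cond_exp Q (F (k - 1)) M | M. ?A M}"
  have U: "is_ess_inf P {\<lambda>\<omega>. ereal (M k \<omega>) | M. M \<in> TC k} ?U" using ess_inf_TC k by simp
  have W: "is_ess_inf P {\<lambda>\<omega>. ereal (M (k - 1) \<omega>) | M. M \<in> TC (k - 1)} ?W" using ess_inf_TC k by simp
  have \<Phi>: "is_ess_inf P ?\<Phi> (ess_inf P ?\<Phi>)"
    by (intro P.is_ess_inf_ess_inf) (auto simp: measurable_P_eq_Q ext_cond_exp_def)
  have "AE \<omega> in P. ess_inf P ?\<Phi> \<omega> \<le> ereal (M (k - 1) \<omega>)" if M: "M \<in> TC (k - 1)" for M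
  proof -
    have Mk: "M \<in> TC k" using TC_tail[OF M] by simp
    then have "AE \<omega> in P. ?U \<omega> \<le> ereal (M k \<omega>)"
      by (intro is_ess_inf_lower[OF U]) blast
    with V have "AE \<omega> in P. V \<omega> \<le> ereal (M k \<omega>)" by eventually_elim simp
    moreover have Mi: "integrable Q (M k)" and "M k \<in> borel_measurable (F k)"
      and "AE \<omega> in Q. real_cond_exp Q (F (k - 1)) (M k) \<omega> \<le> M (k - 1) \<omega>"
      and "loss_constraint P F S l \<alpha> k (M k)"
      using M k by (auto simp: TC_iff)
    ultimately have "?A (M k)" using G.integrable_cond_exp_exists by blast
    then have "AE \<omega> in P. ess_inf P ?\<Phi> \<omega> \<le> ext_cond_exp Q (F (k - 1)) (M k) \<omega>"
      by (intro is_ess_inf_lower[OF \<Phi>]) blast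
    with G.ext_cond_exp_integrable[OF Mi] \<open>AE \<omega> in Q. real_cond_exp Q (F (k - 1)) (M k) \<omega> \<le> M (k - 1) \<omega>\<close>
    show ?thesis unfolding AE_P_iff_Q by eventually_elim (auto intro: order_trans)
  qed
  then have "AE \<omega> in P. ess_inf P ?\<Phi> \<omega> \<le> ?W \<omega>"
    by (intro is_ess_inf_greatest[OF W] is_ess_inf_measurable[OF \<Phi>]) (elim CollectE exE conjE, simp)
  \<comment> \<open>Here \<open>?W\<close> itself takes the place of the lower bound
    \<open>Z\<close>.\<close>
  moreover have "AE \<omega> in P. ?W \<omega> \<le> ext_cond_exp Q (F (k - 1)) M \<omega>" if M: "?A M" for M
  proof (rule TC_lower_bound_le[OF U k])
    show "AE \<omega> in P. ?W \<omega> \<le> ereal (L (k - 1) \<omega>)" if "L \<in> TC (k - 1)" for L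
      by (intro is_ess_inf_lower[OF W]) (use that in blast)
    have "AE \<omega> in P. V \<omega> \<le> ereal (M \<omega>)" using M by blast
    with V show "AE \<omega> in P. ?U \<omega> \<le> ereal (M \<omega>)" by eventually_elim simp
  qed (use M in auto)
  then have "AE \<omega> in P. ?W \<omega> \<le> ess_inf P ?\<Phi> \<omega>"
    by (intro is_ess_inf_greatest[OF \<Phi>] is_ess_inf_measurable[OF W]) (elim CollectE exE conjE, simp)
  ultimately show ?thesis by eventually_elim (rule antisym)
qed

end

theorem proposition6:
  fixes P Q :: "'a measure"
    and F :: "nat \<Rightarrow> 'a measure"
    and n k :: nat
    and p S :: "nat \<Rightarrow> 'a \<Rightarrow> real"
    and l :: "real \<Rightarrow> real"
    and \<alpha> :: "nat \<Rightarrow> real"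
    and V :: "nat \<Rightarrow> 'a \<Rightarrow> ereal"
  assumes "prob_space P"
    and "prob_space Q" and "sets Q = sets P"
    and "absolutely_continuous P Q" and "absolutely_continuous Q P"
    and "n \<ge> 1"
    and "\<And>i. i \<le> n \<Longrightarrow> subalgebra P (F i)"
    and "\<And>i j. i \<le> j \<Longrightarrow> j \<le> n \<Longrightarrow> sets (F i) \<subseteq> sets (F j)"
    and "\<And>A. A \<in> sets (F 0) \<Longrightarrow> measure P A = 0 \<or> measure P A = 1"
    and "\<And>i. i \<in> {1..n} \<Longrightarrow> p i \<in> borel_measurable (F i)"
    and "\<And>i. i \<in> {1..n} \<Longrightarrow> integrable Q (p i)"
    and "S = (\<lambda>t \<omega>. \<Sum>i=1..t. p i \<omega>)"
    and "convex_on UNIV l" and "antimono l" and "bdd_below (range l)"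
    and "AE \<omega> in P. V n \<omega> = -\<infinity>"
    and "\<And>t. t \<in> {1..n} \<Longrightarrow>
           AE \<omega> in P. V (t - 1) \<omega> =
             ess_inf P {ext_cond_exp Q (F (t - 1)) M | M.
               M \<in> borel_measurable (F t) \<and> cond_exp_exists Q (F (t - 1)) M \<and>
               (AE \<omega> in P. V t \<omega> \<le> ereal (M \<omega>)) \<and> loss_constraint P F S l \<alpha> t M} \<omega>"
    and "k \<le> n"
  shows "AE \<omega> in P. V k \<omega> = ess_inf P {\<lambda>\<omega>. ereal (M k \<omega>) | M. M \<in> M_TC P Q F S l \<alpha> n k} \<omega>"
proof -
  have S_adapted: "S t \<in> borel_measurable (F t)" if "t \<le> n" for t
  proof -
    have "p i \<in> borel_measurable (F t)" if i: "i \<in> {1..t}" for i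
    proof -
      have "subalgebra (F t) (F i)"
        using assms(7)[of i] assms(7)[of t] assms(8)[of i t] i \<open>t \<le> n\<close> by (auto simp: subalgebra_def)
      then show ?thesis using assms(10)[of i] i \<open>t \<le> n\<close> by (auto intro: measurable_from_subalg)
    qed
    then show ?thesis unfolding assms(12) by (intro borel_measurable_sum) auto
  qed
  have S_integrable: "integrable Q (S t)" if "t \<le> n" for t
    unfolding assms(12) using assms(11) that by (intro Bochner_Integration.integrable_sum) auto
  interpret constrained_setting P Q F S l \<alpha> n
    by (intro constrained_setting.intro assms S_adapted S_integrable)
  \<comment> \<open>The induction runs downwards from \<open>n\<close>; its step passes from
    \<open>Suc j\<close> to \<open>j\<close>, so the recursion is used at \<open>t = Suc j\<close>,
    where \<open>t - 1\<close> is \<open>j\<close>.\<close>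
  from \<open>k \<le> n\<close> show ?thesis
  proof (induction rule: inc_induct)
    case base
    from assms(16) ess_inf_TC_final show ?case by eventually_elim simp
  next
    case (step j)
    have j: "1 \<le> Suc j" "Suc j \<le> n" using step by auto
    have "AE \<omega> in P. V (Suc j - 1) \<omega> =
        ess_inf P {ext_cond_exp Q (F (Suc j - 1)) M | M.
          M \<in> borel_measurable (F (Suc j)) \<and> cond_exp_exists Q (F (Suc j - 1)) M \<and>
          (AE \<omega> in P. V (Suc j) \<omega> \<le> ereal (M \<omega>)) \<and> loss_constraint P F S l \<alpha> (Suc j) M} \<omega>"
      using j by (intro assms(17)) auto
    with ess_inf_TC_step[OF j step.IH] show ?case by eventually_elim simp
  qed
qed

end
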